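(* Let an integration structure be given with $\mathcal H$ a class of subsets of $\Omega$, $X,Y$ vector spaces with net convergence structures, and $Z$ a lattice normed space with lattice norm $\|\cdot\|:Z\to\mathcal Z^+$, where the Riesz space $\mathcal Z$ is equipped with $(D)$-convergence and is weakly $\sigma$-distributive. Let $f:\Omega\to X$ be net Riemann integrable with respect to a set function $\mu:\mathcal H\to Y$ and suppose: (i) $f$ is subset integrable: if $f$ is net Riemann integrable on $B\in\mathcal H$, then it is net Riemann integrable on each $A\subseteq B$, $A\in\mathcal H$. (ii) The net Riemann integral of $f$ is additive (even when the sets are not disjoint) on the sets forming the set component $\sigma_\gamma$ of the integration net for each $\gamma\in\Gamma(B)$, for each $B\in\mathcal H$ on which $f$ is net Riemann integrable (i.e. the integral over a union of such sets is the sum of the integrals). (iii) For all $B\in\mathcal H$ on which $f$ is net Riemann integrable, and each $\gamma\in\Gamma(B)$, the sets of $\sigma_\gamma$ have union $B$. (iv) Let $B\in\mathcal H$ be such that $f$ is net Riemann integrable on $B$ and let $\{B_j\}_{j=1}^n$ be the finite collection of sets corresponding to some $\gamma\in\Gamma(B)$. Then for each subcollection $\{B_j\}_{j\in J}$ and each $\gamma^0\in\Gamma(\bigcup_{j\in J}B_j)$ there exist $\gamma^*\in\Gamma(\bigcup_{j\in J}B_j)$ with $\gamma^*\ge\gamma^0$, and $\gamma^{(B)}\in\Gamma(B)$ with $\gamma^{(B)}\ge\gamma$, such that the tagged family of $\gamma^{(B)}$ consists of the tagged family of $\gamma^*$ together with the sets $B_k$, $k\in\{1,\dots,n\}\setminus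 J$, tagged by their points in $\gamma$. Let $B\in\mathcal H$ be such that $f$ is net Riemann integrable on $B$. Let $\{a_{ij}\}$ be a regulator in $\mathcal Z$ such that for every $\varphi\in\mathbb N^{\mathbb N}$ there exists $\gamma^{0,B}\in\Gamma(B)$ with $$\Big\|\int_B f\,d\mu-\sum_{i\in I_\gamma}f(\tau_{\gamma_i})\mu(\sigma_{\gamma_i})\Big\|\le\bigvee_{i=1}^\infty a_{i\varphi(i)}\qquad\text{for each }\gamma\ge\gamma^{0,B}.$$ Write $\{B_k\}_{k=1}^n$ for the sets and $\{\tau^{0,B_k}\}_{k=1}^n$ for the corresponding points of the integration net at $\gamma^{0,B}$. Then for every $K=\{1,\dots,n\}\setminus J$, where $J$ is a proper subset of $\{1,\dots,n\}$, $$\Big\|\sum_{k\in K}\int_{B_k}f\,d\mu-\sum_{k\in K}f(\tau^{0,B_k})\mu(B_k)\Big\|\le\bigvee_{i=1}^\infty a_{i\varphi(i)}.$$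
   Context: A net convergence structure $\eta$ on a set $V$ assigns to each $v\in V$ a class of nets in $V$ ("converging to $v$") such that: (i) constant nets $v$ converge to $v$; (ii) every quasi-subnet of a net converging to $v$ converges to $v$, where $(y_j)_{j\in J}$ is a quasi-subnet of $(x_i)_{i\in I}$ if for every $i_0$ there is $j_0$ with $\{y_j:j\ge j_0\}\subseteq\{x_i:i\ge i_0\}$; (iii) if $(x_i)_{i\in I},(y_i)_{i\in I}$ converge to $v$ and $z_i\in\{x_i,y_i\}$ for all $i$, then $(z_i)$ converges to $v$. Standing assumptions: real vector spaces, Archimedean Riesz spaces, Hausdorff structures (unique limits), continuous addition and multiplication by fixed reals. Integration structure: a set $\Omega$ with a class $\mathcal H\subseteq2^\Omega$ (in this part of the paper a $\sigma$-algebra); for each $A\in\mathcal H$ a net $\{(\sigma_\gamma,\tau_\gamma)\}_{\gamma\in\Gamma(A)}$, where $\Gamma(A)$ is a directed set and $\sigma_\gamma=\{\sigma_{\gamma_i}\}_{i\in I_\gamma}$, $\tau_\gamma=\{\tau_{\gamma_i}\}_{i\in I_\gamma}$ are finite families in $\mathcal H$ and $\Omega$ (the set $\sigma_{\gamma_i}$ is tagged by the point $\tau_{\gamma_i}$); vector spaces $X,Y,Z$ with net convergence structures; a bilinear product $X\times Y\to Z$ (juxtaposition), i.e. a bilinear map continuous in each argument separately. The net Riemann integral is $\int_A f\,d\mu=\lim_{\gamma\in\Gamma(A)}\sum_{i\in I_\gamma}f(\tau_{\gamma_i})\mu(\sigma_{\gamma_i})$ in $Z$ when it exists. Convention: the nets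 consist of sets such that $\sum_{i\in I_\gamma}\mu(\sigma_{\gamma_i})=\mu(\bigcup_{i\in I_\gamma}\sigma_{\gamma_i})$ for $\mu$ finitely additive. A lattice norm is a map $\|\cdot\|:Z\to\mathcal Z^+$ into the positive cone of a Riesz space with $\|z\|=0\iff z=0$ and $\|z+w\|\le\|z\|+\|w\|$. Convergence in $Z$: $z_i\to z$ iff $\|z-z_i\|\to0$ in $\mathcal Z$ (here in the sense of $(D)$-convergence). A regulator ($(D)$-sequence) is a double sequence $\{a_{ij}\}$ with $a_{ij}\ge a_{i,j+1}$ and $\bigwedge_j a_{ij}=0$ for all $i$. A net $(x_i)$ $(D)$-converges to $x$ if there is a regulator such that for every $\varphi\in\mathbb N^{\mathbb N}$ there is $i_0$ with $|x_i-x|\le\bigvee_j a_{j\varphi(j)}$ for $i\ge i_0$ (suprema understood to exist). Weakly $\sigma$-distributive means $\bigwedge_{\varphi\in\mathbb N^{\mathbb N}}\bigvee_i a_{i\varphi(i)}=0$ for every regulator. *)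

theory Defs
  imports "HOL-Analysis.Analysis" "HOL-Library.Lattice_Algebras" "HOL-Library.Lub_Glb"
    "HOL-Library.Multiset"
begin

section \<open>Nets and net convergence structures\<close>

text \<open>A net is a function on a directed set \<open>D\<close>, which is a nonempty set of indices with a relation
  \<open>le\<close>; only the values on \<open>D\<close> matter.  HOL cannot quantify over all index types inside a formula,
  so the index type \<open>'i\<close> is a type parameter of every notion below.  This does not lose generality,
  since any set of directed sets embeds into a single sufficiently large type.\<close>

definition directed_set :: "'i set \<Rightarrow> ('i \<Rightarrow> 'i \<Rightarrow> bool) \<Rightarrow> bool" where
  "directed_set D le \<longleftrightarrow> D \<noteq> {} \<and> reflp_on D le \<and> transp_on D le \<and>
     (\<forall>i\<in>D. \<forall>j\<in>D. \<exists>k\<in>D. le i k \<and> le j k)"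

definition net_tail :: "'i set \<Rightarrow> ('i \<Rightarrow> 'i \<Rightarrow> bool) \<Rightarrow> ('i \<Rightarrow> 'v) \<Rightarrow> 'i \<Rightarrow> 'v set" where
  "net_tail D le x i0 = x ` {i \<in> D. le i0 i}"

definition quasi_subnet ::
  "'i set \<Rightarrow> ('i \<Rightarrow> 'i \<Rightarrow> bool) \<Rightarrow> ('i \<Rightarrow> 'v) \<Rightarrow> 'i set \<Rightarrow> ('i \<Rightarrow> 'i \<Rightarrow> bool) \<Rightarrow> ('i \<Rightarrow> 'v) \<Rightarrow> bool" where
  "quasi_subnet E le' y D le x \<longleftrightarrow>
     (\<forall>i0\<in>D. \<exists>j0\<in>E. net_tail E le' y j0 \<subseteq> net_tail D le x i0)"

type_synonym ('i, 'v) net_conv = "'i set \<Rightarrow> ('i \<Rightarrow> 'i \<Rightarrow> bool) \<Rightarrow> ('i \<Rightarrow> 'v) \<Rightarrow> 'v \<Rightarrow> bool"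

locale net_convergence_structure =
  fixes conv :: "('i, 'v) net_conv"
  assumes const: "directed_set D le \<Longrightarrow> conv D le (\<lambda>_. v) v"
    and quasi_subnet: "\<lbrakk>directed_set D le; directed_set E le'; conv D le x v; quasi_subnet E le' y D le x\<rbrakk>
      \<Longrightarrow> conv E le' y v"
    and mix: "\<lbrakk>directed_set D le; conv D le x v; conv D le y v; \<forall>i\<in>D. z i \<in> {x i, y i}\<rbrakk>
      \<Longrightarrow> conv D le z v"

locale net_convergence_vector_space = net_convergence_structure conv
  for conv :: "('i, 'v::real_vector) net_conv" +
  assumes hausdorff: "\<lbrakk>directed_set D le; conv D le x v; conv D le x w\<rbrakk> \<Longrightarrow> v = w"
    and add: "\<lbrakk>directed_set D le; conv D le x v; conv D le y w\<rbrakk> \<Longrightarrow> conv D le (\<lambda>i. x i + y i) (v + w)"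
    and scaleR: "\<lbrakk>directed_set D le; conv D le x v\<rbrakk> \<Longrightarrow> conv D le (\<lambda>i. r *\<^sub>R x i) (r *\<^sub>R v)"

definition separately_continuous ::
  "('i, 'x) net_conv \<Rightarrow> ('i, 'y) net_conv \<Rightarrow> ('i, 'z) net_conv \<Rightarrow> ('x \<Rightarrow> 'y \<Rightarrow> 'z) \<Rightarrow> bool" where
  "separately_continuous convX convY convZ p \<longleftrightarrow>
     (\<forall>D le u x y. directed_set D le \<longrightarrow> convX D le u x \<longrightarrow> convZ D le (\<lambda>i. p (u i) y) (p x y)) \<and>
     (\<forall>D le x v y. directed_set D le \<longrightarrow> convY D le v y \<longrightarrow> convZ D le (\<lambda>i. p x (v i)) (p x y))"


section \<open>Riesz spaces and (D)-convergence\<close>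

class archimedean_riesz_space = ordered_real_vector + lattice_ab_group_add_abs +
  assumes archimedean: "\<lbrakk>0 \<le> x; \<And>n::nat. real n *\<^sub>R x \<le> y\<rbrakk> \<Longrightarrow> x = 0"

definition regulator :: "(nat \<Rightarrow> nat \<Rightarrow> 'r::archimedean_riesz_space) \<Rightarrow> bool" where
  "regulator a \<longleftrightarrow> (\<forall>i j. a i (Suc j) \<le> a i j) \<and> (\<forall>i. isGlb UNIV (range (a i)) 0)"

text \<open>The space need not be Dedekind complete, so the suprema \<open>\<Or>\<^sub>i a\<^sub>i\<^sub>,\<^sub>\<phi>\<^sub>(\<^sub>i\<^sub>)\<close> may fail to exist;
  \<open>diag_sup\<close> is only meaningful together with \<open>has_diag_sups\<close>.\<close>

definition has_diag_sups :: "(nat \<Rightarrow> nat \<Rightarrow> 'r::archimedean_riesz_space) \<Rightarrow> bool" where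
  "has_diag_sups a \<longleftrightarrow> (\<forall>\<phi>. \<exists>s. isLub UNIV (range (\<lambda>i. a i (\<phi> i))) s)"

definition diag_sup :: "(nat \<Rightarrow> nat \<Rightarrow> 'r::archimedean_riesz_space) \<Rightarrow> (nat \<Rightarrow> nat) \<Rightarrow> 'r" where
  "diag_sup a \<phi> = (THE s. isLub UNIV (range (\<lambda>i. a i (\<phi> i))) s)"

definition D_converges :: "('i, 'r::archimedean_riesz_space) net_conv" where
  "D_converges D le x l \<longleftrightarrow> (\<exists>a. regulator a \<and> has_diag_sups a \<and>
     (\<forall>\<phi>. \<exists>i0\<in>D. \<forall>i\<in>D. le i0 i \<longrightarrow> \<bar>x i - l\<bar> \<le> diag_sup a \<phi>))"

definition weakly_sigma_distributive :: "'r::archimedean_riesz_space itself \<Rightarrow> bool" where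
  "weakly_sigma_distributive _ \<longleftrightarrow>
     (\<forall>a::nat \<Rightarrow> nat \<Rightarrow> 'r. regulator a \<longrightarrow> has_diag_sups a \<longrightarrow> isGlb UNIV (range (diag_sup a)) 0)"

locale lattice_norm =
  fixes N :: "'z::real_vector \<Rightarrow> 'r::archimedean_riesz_space"
  assumes nonneg: "0 \<le> N z"
    and eq_zero_iff: "N z = 0 \<longleftrightarrow> z = 0"
    and triangle: "N (z + w) \<le> N z + N w"

definition norm_converges ::
  "('z::real_vector \<Rightarrow> 'r::archimedean_riesz_space) \<Rightarrow> ('i, 'z) net_conv" where
  "norm_converges N D le x z \<longleftrightarrow> D_converges D le (\<lambda>i. N (z - x i)) 0"


section \<open>Integration structures and the net Riemann integral\<close>

text \<open>\<open>\<Gamma> S A\<close> with the order \<open>le S A\<close> is the directed set belonging to \<open>A\<close>; for \<open>\<gamma>\<close> in it,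
  \<open>idx S A \<gamma>\<close> is the finite index set of the tagged family, with sets \<open>cell S A \<gamma> i\<close> and points
  \<open>tag S A \<gamma> i\<close>.  The argument \<open>A\<close> is needed in all of them because the directed sets of different
  \<open>A\<close> may share elements of \<open>'i\<close>.\<close>

record ('o, 'i, 'k) integration_struct =
  base :: "'o set" ("\<Omega>")
  hsets :: "'o set set" ("\<H>")
  net_index :: "'o set \<Rightarrow> 'i set" ("\<Gamma>")
  le :: "'o set \<Rightarrow> 'i \<Rightarrow> 'i \<Rightarrow> bool"
  idx :: "'o set \<Rightarrow> 'i \<Rightarrow> 'k set"
  cell :: "'o set \<Rightarrow> 'i \<Rightarrow> 'k \<Rightarrow> 'o set"
  tag :: "'o set \<Rightarrow> 'i \<Rightarrow> 'k \<Rightarrow> 'o"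

locale integration_structure =
  fixes S :: "('o, 'i, 'k) integration_struct"
  assumes sigma_algebra: "sigma_algebra (\<Omega> S) (\<H> S)"
    and directed: "A \<in> \<H> S \<Longrightarrow> directed_set (\<Gamma> S A) (le S A)"
    and finite_idx: "\<lbrakk>A \<in> \<H> S; \<gamma> \<in> \<Gamma> S A\<rbrakk> \<Longrightarrow> finite (idx S A \<gamma>)"
    and cell_in: "\<lbrakk>A \<in> \<H> S; \<gamma> \<in> \<Gamma> S A; i \<in> idx S A \<gamma>\<rbrakk> \<Longrightarrow> cell S A \<gamma> i \<in> \<H> S"
    and tag_in: "\<lbrakk>A \<in> \<H> S; \<gamma> \<in> \<Gamma> S A; i \<in> idx S A \<gamma>\<rbrakk> \<Longrightarrow> tag S A \<gamma> i \<in> \<Omega> S"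

text \<open>The cells of a family need not be disjoint, but by convention overlaps do not affect sums of a
  finitely additive \<open>\<mu>\<close>; for other set functions nothing is required.\<close>

definition additive_on_nets ::
  "('o, 'i, 'k) integration_struct \<Rightarrow> ('o set \<Rightarrow> 'y::real_vector) \<Rightarrow> bool" where
  "additive_on_nets S \<mu> \<longleftrightarrow>
     (Measure_Space.additive (\<H> S) \<mu> \<longrightarrow>
       (\<forall>A\<in>\<H> S. \<forall>\<gamma>\<in>\<Gamma> S A. (\<Sum>i\<in>idx S A \<gamma>. \<mu> (cell S A \<gamma> i)) = \<mu> (\<Union>i\<in>idx S A \<gamma>. cell S A \<gamma> i)))"

text \<open>The subfamily with indices in \<open>J\<close>, up to renaming of the indices.\<close>

definition tagged_family ::
  "('o, 'i, 'k) integration_struct \<Rightarrow> 'o set \<Rightarrow> 'i \<Rightarrow> 'k set \<Rightarrow> ('o set \<times> 'o) multiset" where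
  "tagged_family S A \<gamma> J = image_mset (\<lambda>i. (cell S A \<gamma> i, tag S A \<gamma> i)) (mset_set J)"

text \<open>In the following, \<open>p\<close> is the product \<open>X \<times> Y \<rightarrow> Z\<close> and \<open>conv\<close> the convergence of \<open>Z\<close>.\<close>

definition riemann_sum ::
  "('o, 'i, 'k) integration_struct \<Rightarrow> ('x \<Rightarrow> 'y \<Rightarrow> 'z::real_vector) \<Rightarrow> ('o \<Rightarrow> 'x) \<Rightarrow> ('o set \<Rightarrow> 'y) \<Rightarrow>
    'o set \<Rightarrow> 'i \<Rightarrow> 'z" where
  "riemann_sum S p f \<mu> A \<gamma> = (\<Sum>i\<in>idx S A \<gamma>. p (f (tag S A \<gamma> i)) (\<mu> (cell S A \<gamma> i)))"

definition has_net_integral ::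
  "('o, 'i, 'k) integration_struct \<Rightarrow> ('i, 'z::real_vector) net_conv \<Rightarrow> ('x \<Rightarrow> 'y \<Rightarrow> 'z) \<Rightarrow>
    ('o \<Rightarrow> 'x) \<Rightarrow> ('o set \<Rightarrow> 'y) \<Rightarrow> 'o set \<Rightarrow> 'z \<Rightarrow> bool" where
  "has_net_integral S conv p f \<mu> A z \<longleftrightarrow> conv (\<Gamma> S A) (le S A) (riemann_sum S p f \<mu> A) z"

definition net_integrable ::
  "('o, 'i, 'k) integration_struct \<Rightarrow> ('i, 'z::real_vector) net_conv \<Rightarrow> ('x \<Rightarrow> 'y \<Rightarrow> 'z) \<Rightarrow>
    ('o \<Rightarrow> 'x) \<Rightarrow> ('o set \<Rightarrow> 'y) \<Rightarrow> 'o set \<Rightarrow> bool" where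
  "net_integrable S conv p f \<mu> A \<longleftrightarrow> (\<exists>z. has_net_integral S conv p f \<mu> A z)"

definition net_integral ::
  "('o, 'i, 'k) integration_struct \<Rightarrow> ('i, 'z::real_vector) net_conv \<Rightarrow> ('x \<Rightarrow> 'y \<Rightarrow> 'z) \<Rightarrow>
    ('o \<Rightarrow> 'x) \<Rightarrow> ('o set \<Rightarrow> 'y) \<Rightarrow> 'o set \<Rightarrow> 'z" where
  "net_integral S conv p f \<mu> A = (THE z. has_net_integral S conv p f \<mu> A z)"

definition subset_integrable ::
  "('o, 'i, 'k) integration_struct \<Rightarrow> ('i, 'z::real_vector) net_conv \<Rightarrow> ('x \<Rightarrow> 'y \<Rightarrow> 'z) \<Rightarrow>
    ('o \<Rightarrow> 'x) \<Rightarrow> ('o set \<Rightarrow> 'y) \<Rightarrow> bool" where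
  "subset_integrable S conv p f \<mu> \<longleftrightarrow>
     (\<forall>B\<in>\<H> S. net_integrable S conv p f \<mu> B \<longrightarrow>
       (\<forall>A\<in>\<H> S. A \<subseteq> B \<longrightarrow> net_integrable S conv p f \<mu> A))"

text \<open>Unions of subfamilies are taken over sets of indices, so a cell occurring twice is counted twice.
  Only nonempty subfamilies are considered, so the integral over the empty set is not constrained.\<close>

definition integral_additive_on_cells ::
  "('o, 'i, 'k) integration_struct \<Rightarrow> ('i, 'z::real_vector) net_conv \<Rightarrow> ('x \<Rightarrow> 'y \<Rightarrow> 'z) \<Rightarrow>
    ('o \<Rightarrow> 'x) \<Rightarrow> ('o set \<Rightarrow> 'y) \<Rightarrow> bool" where
  "integral_additive_on_cells S conv p f \<mu> \<longleftrightarrow>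
     (\<forall>B\<in>\<H> S. net_integrable S conv p f \<mu> B \<longrightarrow>
       (\<forall>\<gamma>\<in>\<Gamma> S B. \<forall>J. J \<subseteq> idx S B \<gamma> \<longrightarrow> J \<noteq> {} \<longrightarrow>
         net_integral S conv p f \<mu> (\<Union>j\<in>J. cell S B \<gamma> j) =
         (\<Sum>j\<in>J. net_integral S conv p f \<mu> (cell S B \<gamma> j))))"

end

theory Submission
  imports Defs
begin

text \<open>Let \<open>J\<close> be the set of indices left out and \<open>U\<close> the union of the corresponding cells of
  \<open>\<gamma>\<^sub>0\<close>.  Refine only these cells: by hypothesis \<open>iv\<close>, arbitrarily late in \<open>\<Gamma>(U)\<close> there is a
  \<open>\<gamma>'\<close> whose tagged family, completed by the cells of \<open>\<gamma>\<^sub>0\<close> with index in \<open>K\<close>, is that of some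
  \<open>\<gamma>\<close> above \<open>\<gamma>\<^sub>0\<close> in \<open>\<Gamma>(B)\<close>.  Write \<open>s\<close> for Riemann sums and \<open>\<integral>\<close> for integrals of \<open>f\<close>.
  The integral over \<open>B\<close> splits, by additivity on cells, and the sum at \<open>\<gamma>\<close> splits, by the choice
  of \<open>\<gamma>\<close>; subtraction gives
  \<open>\<Sum>\<^sub>k\<^sub>\<in>\<^sub>K (\<integral>\<^sub>B\<^sub>k - f(\<tau>\<^sub>k)\<mu>(B\<^sub>k)) = (\<integral>\<^sub>B - s\<^sub>B(\<gamma>)) + (s\<^sub>U(\<gamma>') - \<integral>\<^sub>U)\<close>.
  The norm of the first bracket is bounded by the given \<open>\<Or>\<^sub>i a\<^sub>i\<^sub>\<phi>\<^sub>(\<^sub>i\<^sub>)\<close>.  The left side does not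
  depend on \<open>\<gamma>'\<close>, and the second bracket tends to \<open>0\<close>, so it can be dropped from the estimate; this
  is where weak \<open>\<sigma>\<close>-distributivity enters, since convergence bounds the bracket only by the diagonal
  suprema of a regulator (lemma \<open>le_of_frequently_le_add_null\<close>).

  Two points need care.  A lattice norm need not be symmetric, while convergence controls
  \<open>\<parallel>\<integral>\<^sub>U - s\<^sub>U\<parallel>\<close> and the estimate needs \<open>\<parallel>s\<^sub>U - \<integral>\<^sub>U\<parallel>\<close>; the passage from one to the other is
  continuity of multiplication by \<open>-1\<close> (lemma \<open>norm_converges_swap\<close>).  And for empty \<open>J\<close> the
  integral over \<open>U = {}\<close> is not known to vanish; but then the left side is just
  \<open>\<integral>\<^sub>B - s\<^sub>B(\<gamma>\<^sub>0)\<close> and no refinement is needed.\<close>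

text \<open>Read the convergence \<open>-x \<rightarrow> -z\<close>: the error of the net \<open>-x\<close> is \<open>-z - (-x i) = x i - z\<close>.
  The type annotation ties the assumption on \<open>norm_converges N\<close> to the index type of the given net;
  without it the two occurrences of this polymorphic constant would be unrelated.\<close>

lemma norm_converges_swap:
  fixes D :: "'i set"
  assumes "net_convergence_vector_space (norm_converges N :: ('i, 'z::real_vector) net_conv)"
    and "directed_set D leq" "norm_converges N D leq x z"
  shows "D_converges D leq (\<lambda>i. N (x i - z)) 0"
proof -
  interpret net_convergence_vector_space "norm_converges N :: ('i, 'z) net_conv" by (rule assms(1))
  have "norm_converges N D leq (\<lambda>i. (- 1) *\<^sub>R x i) ((- 1) *\<^sub>R z)"
    by (rule scaleR[OF assms(2,3)])
  then show ?thesis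
    by (simp add: norm_converges_def)
qed

text \<open>Each diagonal supremum of a regulator for \<open>e\<close> bounds \<open>e\<close> at some index where the hypothesis
  applies, so \<open>u - c\<close> is a lower bound of all of them; their infimum is \<open>0\<close>.\<close>

lemma le_of_frequently_le_add_null:
  fixes u c :: "'r::archimedean_riesz_space"
  assumes wsd: "weakly_sigma_distributive TYPE('r)"
    and null: "D_converges D leq e 0"
    and freq: "\<And>i\<^sub>0. i\<^sub>0 \<in> D \<Longrightarrow> \<exists>i\<in>D. leq i\<^sub>0 i \<and> u \<le> c + e i"
  shows "u \<le> c"
proof -
  obtain b where b: "regulator b" "has_diag_sups b"
    and bound: "\<And>\<psi>. \<exists>i\<^sub>0\<in>D. \<forall>i\<in>D. leq i\<^sub>0 i \<longrightarrow> \<bar>e i\<bar> \<le> diag_sup b \<psi>"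
    using null unfolding D_converges_def by auto
  have "u - c \<le> diag_sup b \<psi>" for \<psi>
  proof -
    obtain i\<^sub>0 where i\<^sub>0: "i\<^sub>0 \<in> D" "\<And>i. i \<in> D \<Longrightarrow> leq i\<^sub>0 i \<Longrightarrow> \<bar>e i\<bar> \<le> diag_sup b \<psi>"
      using bound by blast
    obtain i where i: "i \<in> D" "leq i\<^sub>0 i" "u \<le> c + e i"
      using freq i\<^sub>0(1) by blast
    have "u - c \<le> e i"
      using i(3) by (simp add: diff_le_eq add.commute)
    also have "\<dots> \<le> \<bar>e i\<bar>"
      by (rule abs_ge_self)
    also have "\<dots> \<le> diag_sup b \<psi>"
      using i(1,2) by (rule i\<^sub>0(2))
    finally show ?thesis .
  qed
  then have "isLb UNIV (range (diag_sup b)) (u - c)"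
    by (auto simp: isLb_def setge_def)
  moreover have "isGlb UNIV (range (diag_sup b)) 0"
    using wsd b by (simp add: weakly_sigma_distributive_def)
  ultimately have "u - c \<le> 0"
    by (auto simp: isGlb_def greatestP_def setle_def)
  then show ?thesis
    by simp
qed

lemma has_net_integral_net_integral:
  assumes "net_convergence_vector_space conv" "directed_set (\<Gamma> S A) (le S A)"
    and "net_integrable S conv p f \<mu> A"
  shows "has_net_integral S conv p f \<mu> A (net_integral S conv p f \<mu> A)"
proof -
  obtain z where z: "has_net_integral S conv p f \<mu> A z"
    using assms(3) by (auto simp: net_integrable_def)
  show ?thesis
    unfolding net_integral_def
  proof (rule theI)
    show "w = z" if "has_net_integral S conv p f \<mu> A w" for w
      using net_convergence_vector_space.hausdorff[OF assms(1,2)] that z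
      unfolding has_net_integral_def by blast
  qed (rule z)
qed

text \<open>A Riemann sum depends on the tagged family only as a multiset, so it splits along any
  decomposition of that multiset.\<close>

lemma sum_eq_sum_mset_tagged_family:
  "(\<Sum>i\<in>J. p (f (tag S A \<gamma> i)) (\<mu> (cell S A \<gamma> i))) =
    (\<Sum>(E, t)\<in>#tagged_family S A \<gamma> J. p (f t) (\<mu> E))"
  by (simp add: tagged_family_def sum_unfold_sum_mset multiset.map_comp comp_def)

lemma riemann_sum_split:
  assumes "tagged_family S B \<gamma> (idx S B \<gamma>) =
      tagged_family S U \<gamma>' (idx S U \<gamma>') + tagged_family S B \<gamma>\<^sub>0 K"
  shows "riemann_sum S p f \<mu> B \<gamma> =
      riemann_sum S p f \<mu> U \<gamma>' + (\<Sum>k\<in>K. p (f (tag S B \<gamma>\<^sub>0 k)) (\<mu> (cell S B \<gamma>\<^sub>0 k)))"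
  using assms by (simp add: riemann_sum_def sum_eq_sum_mset_tagged_family)

theorem theorem4p6:
  fixes S :: "('o, 'i, 'k) integration_struct"
    and convX :: "('i, 'x::real_vector) net_conv"
    and convY :: "('i, 'y::real_vector) net_conv"
    and convZ :: "('i, 'z::real_vector) net_conv"
    and N :: "'z \<Rightarrow> 'r::archimedean_riesz_space"
    and p :: "'x \<Rightarrow> 'y \<Rightarrow> 'z"
    and f :: "'o \<Rightarrow> 'x"
    and \<mu> :: "'o set \<Rightarrow> 'y"
    and a :: "nat \<Rightarrow> nat \<Rightarrow> 'r"
  assumes struct: "integration_structure S"
    and X: "net_convergence_vector_space convX"
    and Y: "net_convergence_vector_space convY"
    and Z: "net_convergence_vector_space convZ"
    and normZ: "lattice_norm N"
    and convZ: "convZ = norm_converges N"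
    and wsd: "weakly_sigma_distributive TYPE('r)"
    and p: "bilinear p" "separately_continuous convX convY convZ p"
    and nets: "additive_on_nets S \<mu>"
    and i: "subset_integrable S convZ p f \<mu>"
    and ii: "integral_additive_on_cells S convZ p f \<mu>"
    and iii: "\<And>B \<gamma>. \<lbrakk>B \<in> \<H> S; net_integrable S convZ p f \<mu> B; \<gamma> \<in> \<Gamma> S B\<rbrakk>
      \<Longrightarrow> (\<Union>k\<in>idx S B \<gamma>. cell S B \<gamma> k) = B"
    and iv: "\<And>B \<gamma> J U \<gamma>\<^sub>0. \<lbrakk>B \<in> \<H> S; net_integrable S convZ p f \<mu> B; \<gamma> \<in> \<Gamma> S B; J \<subseteq> idx S B \<gamma>;
        U = (\<Union>j\<in>J. cell S B \<gamma> j); \<gamma>\<^sub>0 \<in> \<Gamma> S U\<rbrakk>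
      \<Longrightarrow> \<exists>\<gamma>'\<in>\<Gamma> S U. \<exists>\<gamma>B\<in>\<Gamma> S B. le S U \<gamma>\<^sub>0 \<gamma>' \<and> le S B \<gamma> \<gamma>B \<and>
        tagged_family S B \<gamma>B (idx S B \<gamma>B) =
          tagged_family S U \<gamma>' (idx S U \<gamma>') + tagged_family S B \<gamma> (idx S B \<gamma> - J)"
    and B: "B \<in> \<H> S" "net_integrable S convZ p f \<mu> B"
    and a: "regulator a" "has_diag_sups a"
      "\<forall>\<phi>. \<exists>\<gamma>\<^sub>0\<in>\<Gamma> S B. \<forall>\<gamma>\<in>\<Gamma> S B. le S B \<gamma>\<^sub>0 \<gamma> \<longrightarrow>
        N (net_integral S convZ p f \<mu> B - riemann_sum S p f \<mu> B \<gamma>) \<le> diag_sup a \<phi>"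
  shows "\<forall>\<phi>. \<forall>\<gamma>\<^sub>0\<in>\<Gamma> S B.
      (\<forall>\<gamma>\<in>\<Gamma> S B. le S B \<gamma>\<^sub>0 \<gamma> \<longrightarrow>
        N (net_integral S convZ p f \<mu> B - riemann_sum S p f \<mu> B \<gamma>) \<le> diag_sup a \<phi>) \<longrightarrow>
      (\<forall>J K. J \<subset> idx S B \<gamma>\<^sub>0 \<longrightarrow> K = idx S B \<gamma>\<^sub>0 - J \<longrightarrow>
        N ((\<Sum>k\<in>K. net_integral S convZ p f \<mu> (cell S B \<gamma>\<^sub>0 k))
            - (\<Sum>k\<in>K. p (f (tag S B \<gamma>\<^sub>0 k)) (\<mu> (cell S B \<gamma>\<^sub>0 k)))) \<le> diag_sup a \<phi>)"
proof (intro allI ballI impI)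
  fix \<phi> \<gamma>\<^sub>0 J K
  assume \<gamma>\<^sub>0: "\<gamma>\<^sub>0 \<in> \<Gamma> S B"
    and bound: "\<forall>\<gamma>\<in>\<Gamma> S B. le S B \<gamma>\<^sub>0 \<gamma> \<longrightarrow>
      N (net_integral S convZ p f \<mu> B - riemann_sum S p f \<mu> B \<gamma>) \<le> diag_sup a \<phi>"
    and J: "J \<subset> idx S B \<gamma>\<^sub>0" and K: "K = idx S B \<gamma>\<^sub>0 - J"
  interpret integration_structure S by (rule struct)
  let ?int = "net_integral S convZ p f \<mu>" and ?sum = "riemann_sum S p f \<mu>"
  let ?U = "\<Union>j\<in>J. cell S B \<gamma>\<^sub>0 j"
  let ?SK = "\<Sum>k\<in>K. p (f (tag S B \<gamma>\<^sub>0 k)) (\<mu> (cell S B \<gamma>\<^sub>0 k))"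
  let ?d = "(\<Sum>k\<in>K. ?int (cell S B \<gamma>\<^sub>0 k)) - ?SK"
  have fin: "finite (idx S B \<gamma>\<^sub>0)"
    using B(1) \<gamma>\<^sub>0 by (rule finite_idx)
  have additive: "?int (\<Union>j\<in>L. cell S B \<gamma>\<^sub>0 j) = (\<Sum>j\<in>L. ?int (cell S B \<gamma>\<^sub>0 j))"
    if "L \<subseteq> idx S B \<gamma>\<^sub>0" "L \<noteq> {}" for L
    using ii B \<gamma>\<^sub>0 that unfolding integral_additive_on_cells_def by blast
  \<comment> \<open>\<open>J\<close> being proper, the index set is nonempty, so additivity applies to the whole family.\<close>
  have int_B: "?int B = (\<Sum>k\<in>idx S B \<gamma>\<^sub>0. ?int (cell S B \<gamma>\<^sub>0 k))"
    using additive[of "idx S B \<gamma>\<^sub>0"] iii[OF B \<gamma>\<^sub>0] J by auto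
  show "N ?d \<le> diag_sup a \<phi>"
  proof (cases "J = {}")
    case True
    have "le S B \<gamma>\<^sub>0 \<gamma>\<^sub>0"
      using directed[OF B(1)] \<gamma>\<^sub>0 by (simp add: directed_set_def reflp_on_def)
    then have "N (?int B - ?sum B \<gamma>\<^sub>0) \<le> diag_sup a \<phi>"
      using bound \<gamma>\<^sub>0 by blast
    then show ?thesis
      using True K int_B by (simp add: riemann_sum_def)
  next
    case False
    interpret sigma_algebra "\<Omega> S" "\<H> S" by (rule sigma_algebra)
    have U: "?U \<in> \<H> S"
      using J fin cell_in[OF B(1) \<gamma>\<^sub>0] by (intro finite_UN) (auto intro: finite_subset)
    have "?U \<subseteq> B"
      using iii[OF B \<gamma>\<^sub>0] J by blast
    then have "net_integrable S convZ p f \<mu> ?U"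
      using i B U unfolding subset_integrable_def by blast
    then have "norm_converges N (\<Gamma> S ?U) (le S ?U) (?sum ?U) (?int ?U)"
      using has_net_integral_net_integral[OF Z directed[OF U]]
      unfolding has_net_integral_def convZ by blast
    then have null: "D_converges (\<Gamma> S ?U) (le S ?U) (\<lambda>\<gamma>. N (?sum ?U \<gamma> - ?int ?U)) 0"
      by (rule norm_converges_swap[OF Z[unfolded convZ] directed[OF U]])
    have int_split: "?int B = ?int ?U + (\<Sum>k\<in>K. ?int (cell S B \<gamma>\<^sub>0 k))"
      using int_B additive[of J] False J K fin
        sum.subset_diff[of J "idx S B \<gamma>\<^sub>0" "\<lambda>k. ?int (cell S B \<gamma>\<^sub>0 k)"]
      by (simp add: add.commute psubset_imp_subset)
    show ?thesis
    proof (rule le_of_frequently_le_add_null[OF wsd null])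
      fix \<gamma>\<^sub>1
      assume "\<gamma>\<^sub>1 \<in> \<Gamma> S ?U"
      from iv[OF B \<gamma>\<^sub>0 psubset_imp_subset[OF J] refl this]
      obtain \<gamma>' \<gamma> where \<gamma>': "\<gamma>' \<in> \<Gamma> S ?U" "le S ?U \<gamma>\<^sub>1 \<gamma>'"
        and \<gamma>: "\<gamma> \<in> \<Gamma> S B" "le S B \<gamma>\<^sub>0 \<gamma>"
        and family: "tagged_family S B \<gamma> (idx S B \<gamma>) =
          tagged_family S ?U \<gamma>' (idx S ?U \<gamma>') + tagged_family S B \<gamma>\<^sub>0 K"
        unfolding K by blast
      have "?d = (?int B - ?sum B \<gamma>) + (?sum ?U \<gamma>' - ?int ?U)"
        using int_split riemann_sum_split[OF family, of p f \<mu>] by simp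
      then have "N ?d \<le> N (?int B - ?sum B \<gamma>) + N (?sum ?U \<gamma>' - ?int ?U)"
        by (simp only: lattice_norm.triangle[OF normZ])
      also have "\<dots> \<le> diag_sup a \<phi> + N (?sum ?U \<gamma>' - ?int ?U)"
        using bound \<gamma> by (simp add: add_right_mono)
      finally show "\<exists>\<gamma>'\<in>\<Gamma> S ?U. le S ?U \<gamma>\<^sub>1 \<gamma>' \<and> N ?d \<le> diag_sup a \<phi> + N (?sum ?U \<gamma>' - ?int ?U)"
        using \<gamma>' by blast
    qed
  qed
qed

end
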